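(* Let $G$ be a discrete amenable group, $T$ a finite rooted tree with root $r$ and $T^+=T\setminus\{r\}$, and $A\subseteq G$ a set of positive density. Let $(g_n)_{n\in\omega}$ be a sequence of functions $g_n:T^+\to G$. Then there exists a sequence of functions $b_n:T\to\mathrm{FIN}^T$, $t\mapsto b_{n,t}\in\mathrm{FIN}^T_t$, such that $\mathrm{dom}(b_{n,t})<\mathrm{dom}(b_{n+1,t})$ for all $n,t$, and for every finite nonempty $F\subseteq\omega$, regressive homomorphisms $f_e:T\to T$ and nodes $t_e\in T$ ($e\in F$) such that $\{f_e(t_e):e\in F\}$ is a chain in $T$, one has $$\prod_{e\in F}\ \prod_{\substack{j\in\mathrm{dom}(b_{e,t_e})\\ (f_e\circ b_{e,t_e})(j)\in T^+}}\big(g_j\circ f_e\circ b_{e,t_e}\big)(j)\ \in AA^{-1}.$$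
   Context: Density in an amenable group $G$: for $\alpha>0$, $d(A)\ge\alpha$ iff for every finite $F\subseteq G$ and $\varepsilon>0$ there is a finite $I\subseteq G$ with $|A\cap I|\ge(\alpha-\varepsilon)|I|$ and $|gI\,\triangle\,I|<\varepsilon|I|$ for all $g\in F$; $A$ has positive density if $d(A)\ge\alpha$ for some $\alpha>0$. $AA^{-1}=\{gh^{-1}:g,h\in A\}$. Products $\prod_{i\in F}$ over a finite set of integers are taken in increasing order of the index (empty product = identity). $\omega=\{0,1,\dots\}$; for finite $A,B\subseteq\omega$, $A<B$ means every element of $A$ is below every element of $B$ (vacuous for empty sets). $T$ is ordered by $t'\le t$ iff $t'$ is a descendant of or equal to $t$. A regressive homomorphism of $T$ is $f:T\to T$ with $f(t)\ge t$ mapping adjacent nodes to equal or adjacent nodes. $\mathrm{FIN}^T$ is the set of functions $b:\mathrm{dom}(b)\to T^+$ with $\mathrm{dom}(b)$ a finite (possibly empty) subset of $\omega$ and range in a branch of $T$; for $t\in T^+$, $\mathrm{FIN}^T_t$ consists of those $b$ whose range is a nonempty chain with least element $t$, and $\mathrm{FIN}^T_r=\{\emptyset\}$. *)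

theory Defs
  imports Complex_Main "HOL-Algebra.Coset"
begin

text \<open>Amenability of a discrete group: there is a left-invariant finitely additive probability
  measure defined on all subsets of the group.\<close>

locale amenable_group = group G for G (structure) +
  assumes invariant_measure:
    "\<exists>m :: 'a set \<Rightarrow> real.
       m (carrier G) = 1 \<and>
       (\<forall>B. B \<subseteq> carrier G \<longrightarrow> 0 \<le> m B) \<and>
       (\<forall>B C. B \<subseteq> carrier G \<longrightarrow> C \<subseteq> carrier G \<longrightarrow> B \<inter> C = {} \<longrightarrow> m (B \<union> C) = m B + m C) \<and>
       (\<forall>g B. g \<in> carrier G \<longrightarrow> B \<subseteq> carrier G \<longrightarrow> m (g <#\<^bsub>G\<^esub> B) = m B)"

definition density_ge :: "('g, 'm) monoid_scheme \<Rightarrow> 'g set \<Rightarrow> real \<Rightarrow> bool" where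
  "density_ge G A \<alpha> \<longleftrightarrow>
     (\<forall>F \<epsilon>. finite F \<longrightarrow> F \<subseteq> carrier G \<longrightarrow> 0 < \<epsilon> \<longrightarrow>
       (\<exists>I. finite I \<and> I \<subseteq> carrier G \<and>
            real (card (A \<inter> I)) \<ge> (\<alpha> - \<epsilon>) * real (card I) \<and>
            (\<forall>g\<in>F. real (card (sym_diff (g <#\<^bsub>G\<^esub> I) I)) < \<epsilon> * real (card I))))"

definition positive_density :: "('g, 'm) monoid_scheme \<Rightarrow> 'g set \<Rightarrow> bool" where
  "positive_density G A \<longleftrightarrow> (\<exists>\<alpha>>0. density_ge G A \<alpha>)"

definition quotient_set :: "('g, 'm) monoid_scheme \<Rightarrow> 'g set \<Rightarrow> 'g set" where
  "quotient_set G A = {g \<otimes>\<^bsub>G\<^esub> inv\<^bsub>G\<^esub> h | g h. g \<in> A \<and> h \<in> A}"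

text \<open>The product over a finite set of indices, factors in increasing order of the index.\<close>

definition ordered_prod :: "('g, 'm) monoid_scheme \<Rightarrow> (nat \<Rightarrow> 'g) \<Rightarrow> nat set \<Rightarrow> 'g" where
  "ordered_prod G h F = foldr (\<otimes>\<^bsub>G\<^esub>) (map h (sorted_list_of_set F)) \<one>\<^bsub>G\<^esub>"

definition set_before :: "nat set \<Rightarrow> nat set \<Rightarrow> bool" where
  "set_before A B \<longleftrightarrow> (\<forall>a\<in>A. \<forall>b\<in>B. a < b)"

text \<open>A finite rooted tree is given by its set of nodes \<open>T\<close>, its root \<open>r\<close>, and its set \<open>P\<close> of
  edges directed towards the root: \<open>(s, t) \<in> P\<close> means that \<open>t\<close> is the parent of \<open>s\<close>.\<close>

locale finite_rooted_tree =
  fixes T :: "'t set" and r :: 't and P :: "('t \<times> 't) set"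
  assumes finite_nodes: "finite T"
    and root_node: "r \<in> T"
    and edges: "P \<subseteq> (T - {r}) \<times> T"
    and unique_parent: "\<And>s. s \<in> T - {r} \<Longrightarrow> \<exists>!t. (s, t) \<in> P"
    and root_reachable: "\<And>s. s \<in> T \<Longrightarrow> (s, r) \<in> P\<^sup>*"

text \<open>The tree order is reversed with respect to the usual convention: the root is the largest
  node, and \<open>s\<close> lies below \<open>t\<close> iff \<open>s\<close> is a descendant of or equal to \<open>t\<close>.\<close>

definition tree_le :: "('t \<times> 't) set \<Rightarrow> 't \<Rightarrow> 't \<Rightarrow> bool" where
  "tree_le P s t \<longleftrightarrow> (s, t) \<in> P\<^sup>*"

definition tree_chain :: "'t set \<Rightarrow> ('t \<times> 't) set \<Rightarrow> 't set \<Rightarrow> bool" where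
  "tree_chain T P C \<longleftrightarrow> pred_on.chain T (tree_le P) C"

definition tree_branch :: "'t set \<Rightarrow> ('t \<times> 't) set \<Rightarrow> 't set \<Rightarrow> bool" where
  "tree_branch T P C \<longleftrightarrow> pred_on.maxchain T (tree_le P) C"

definition adjacent :: "('t \<times> 't) set \<Rightarrow> 't \<Rightarrow> 't \<Rightarrow> bool" where
  "adjacent P s t \<longleftrightarrow> (s, t) \<in> P \<or> (t, s) \<in> P"

text \<open>Maps \<open>T \<rightarrow> T\<close> are total functions on the type whose values outside \<open>T\<close> are irrelevant.\<close>

definition regressive_hom :: "'t set \<Rightarrow> ('t \<times> 't) set \<Rightarrow> ('t \<Rightarrow> 't) \<Rightarrow> bool" where
  "regressive_hom T P f \<longleftrightarrow>
     f \<in> T \<rightarrow> T \<and>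
     (\<forall>t\<in>T. tree_le P t (f t)) \<and>
     (\<forall>s\<in>T. \<forall>t\<in>T. adjacent P s t \<longrightarrow> f s = f t \<or> adjacent P (f s) (f t))"

definition FIN :: "'t set \<Rightarrow> 't \<Rightarrow> ('t \<times> 't) set \<Rightarrow> (nat \<rightharpoonup> 't) set" where
  "FIN T r P =
     {b. finite (dom b) \<and> ran b \<subseteq> T - {r} \<and> (\<exists>C. tree_branch T P C \<and> ran b \<subseteq> C)}"

definition FIN_at :: "'t set \<Rightarrow> 't \<Rightarrow> ('t \<times> 't) set \<Rightarrow> 't \<Rightarrow> (nat \<rightharpoonup> 't) set" where
  "FIN_at T r P t =
     (if t = r then {Map.empty}
      else {b \<in> FIN T r P. ran b \<noteq> {} \<and> tree_chain T P (ran b) \<and>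
                           t \<in> ran b \<and> (\<forall>s\<in>ran b. tree_le P t s)})"

end

theory Submission
  imports Defs "HOL-Library.Ramsey"
begin

text \<open>The map \<open>b n t\<close> can be taken constant with value \<open>t\<close> on an interval \<open>{a n..<b n}\<close> that does
  not depend on \<open>t\<close>. It then suffices that at every stage, for finitely many sets \<open>B\<close> of positive
  density and all nodes \<open>s\<close> at once, the set of \<open>y \<in> B\<close> with \<open>x \<otimes> y \<in> B\<close> has positive density, where
  \<open>x\<close> is the product of the \<open>g j s\<close> over the next interval; these sets are the \<open>B\<close> of the next stage.
  As \<open>x = inv p a \<otimes> p b\<close> for the partial products \<open>p\<close>, a single such requirement is met by some pair
  from any infinite set of indices, since too many translates of \<open>B\<close> cannot be almost disjoint;
  Ramsey's theorem meets finitely many requirements simultaneously. Every product \<open>w\<close> that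
  occurs after finitely many stages satisfies \<open>w \<otimes> y \<in> A\<close> for all \<open>y\<close> in a nonempty subset of \<open>A\<close>.\<close>

subsection \<open>Ordered products\<close>

lemma ordered_prod_empty [simp]: "ordered_prod G h {} = \<one>\<^bsub>G\<^esub>"
  by (simp add: ordered_prod_def)

lemma ordered_prod_cong:
  assumes "finite F" and "\<And>e. e \<in> F \<Longrightarrow> h e = h' e"
  shows "ordered_prod G h F = ordered_prod G h' F"
proof -
  have "map h (sorted_list_of_set F) = map h' (sorted_list_of_set F)"
    using assms by simp
  then show ?thesis
    by (simp only: ordered_prod_def)
qed

context group
begin

lemma foldr_mult_closed:
  "set xs \<subseteq> carrier G \<Longrightarrow> foldr (\<otimes>) xs \<one> \<in> carrier G"
  by (induction xs) auto

lemma foldr_mult_snoc: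
  assumes "set xs \<subseteq> carrier G" and "x \<in> carrier G"
  shows "foldr (\<otimes>) (xs @ [x]) \<one> = foldr (\<otimes>) xs \<one> \<otimes> x"
  using assms(1)
proof (induction xs)
  case Nil
  then show ?case using assms(2) by simp
next
  case (Cons y ys)
  then have "foldr (\<otimes>) ys \<one> \<in> carrier G" by (intro foldr_mult_closed) auto
  with Cons show ?case using assms(2) by (simp add: m_assoc)
qed

lemma ordered_prod_closed:
  assumes "finite F" and "\<And>e. e \<in> F \<Longrightarrow> h e \<in> carrier G"
  shows "ordered_prod G h F \<in> carrier G"
  unfolding ordered_prod_def using assms by (intro foldr_mult_closed) auto

lemma ordered_prod_insert_greatest:
  assumes "finite F" and less: "\<And>e. e \<in> F \<Longrightarrow> e < n"
    and "\<And>e. e \<in> F \<Longrightarrow> h e \<in> carrier G" and "h n \<in> carrier G"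
  shows "ordered_prod G h (insert n F) = ordered_prod G h F \<otimes> h n"
proof -
  have "n \<notin> F" using less by blast
  have "sorted_list_of_set (insert n F) = sorted_list_of_set F @ [n]"
    using assms(1) less \<open>n \<notin> F\<close>
    by (simp add: sorted_insort_is_snoc less_imp_le)
  moreover have "set (map h (sorted_list_of_set F)) \<subseteq> carrier G"
    using assms by auto
  ultimately show ?thesis
    unfolding ordered_prod_def using foldr_mult_snoc[OF _ assms(4)] by simp
qed

text \<open>This turns an interval product into a quotient of initial products: with
  \<open>p n\<close> the product over \<open>{..<n}\<close>, the product over \<open>{a..<b}\<close>
  is \<open>inv (p a) \<otimes> p b\<close>.\<close>

lemma ordered_prod_interval_split:
  assumes "\<And>e. h e \<in> carrier G" and "a \<le> b"
  shows "ordered_prod G h {..<b} = ordered_prod G h {..<a} \<otimes> ordered_prod G h {a..<b}"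
  using assms(2)
proof (induction b rule: dec_induct)
  case base
  then show ?case using assms(1) by (simp add: ordered_prod_closed)
next
  case (step b)
  have "ordered_prod G h {..<Suc b} = ordered_prod G h {..<b} \<otimes> h b"
    unfolding lessThan_Suc by (rule ordered_prod_insert_greatest) (use assms(1) in auto)
  moreover have "{a..<Suc b} = insert b {a..<b}" using step by auto
  then have "ordered_prod G h {a..<Suc b} = ordered_prod G h {a..<b} \<otimes> h b"
    by (simp only:) (rule ordered_prod_insert_greatest, use assms(1) in auto)
  ultimately show ?case
    using step assms(1) by (simp add: ordered_prod_closed m_assoc)
qed

end

subsection \<open>Positive density\<close>

text \<open>For \<open>h\<close> in the carrier this is the left translate of
  \<open>B \<inter> carrier G\<close> by \<open>inv h\<close>; the preimage form lets membership
  unfold to a product without inverses.\<close>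

definition shift :: "('g, 'm) monoid_scheme \<Rightarrow> 'g \<Rightarrow> 'g set \<Rightarrow> 'g set" where
  "shift G h B = {y \<in> carrier G. h \<otimes>\<^bsub>G\<^esub> y \<in> B}"

context group
begin

text \<open>Left multiplication by \<open>h\<close> maps \<open>shift G h B \<inter> I\<close> onto
  a set covering the part of \<open>B \<inter> I\<close> inside \<open>h <# I\<close>. The rest of
  \<open>B \<inter> I\<close> lies in the symmetric difference.\<close>

lemma card_shift_ge:
  assumes I: "finite I" "I \<subseteq> carrier G" and h: "h \<in> carrier G"
  shows "card (B \<inter> I) \<le> card (shift G h B \<inter> I) + card (sym_diff (h <# I) I)"
proof -
  have hI: "h <# I = (\<lambda>y. h \<otimes> y) ` I" by (auto simp: l_coset_def)
  have "B \<inter> I \<inter> (h <# I) \<subseteq> (\<lambda>y. h \<otimes> y) ` (shift G h B \<inter> I)"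
    using I by (auto simp: hI shift_def)
  then have "card (B \<inter> I \<inter> (h <# I)) \<le> card (shift G h B \<inter> I)"
    by (rule surj_card_le[rotated]) (use I in auto)
  moreover have "card (B \<inter> I) \<le> card (B \<inter> I \<inter> (h <# I)) + card (sym_diff (h <# I) I)"
  proof -
    have "card (B \<inter> I) \<le> card ((B \<inter> I \<inter> (h <# I)) \<union> sym_diff (h <# I) I)"
      by (rule card_mono) (use I in \<open>auto simp: hI\<close>)
    then show ?thesis using card_Un_le order_trans by blast
  qed
  ultimately show ?thesis by linarith
qed

lemma positive_density_nonempty:
  assumes "positive_density G B"
  shows "B \<noteq> {}"
proof
  assume "B = {}"
  obtain \<alpha> where \<alpha>: "\<alpha> > 0" "density_ge G B \<alpha>"
    using assms by (auto simp: positive_density_def)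
  \<comment> \<open>Invariance under \<open>\<one>\<close> is requested for its strict inequality,
    which excludes the empty \<open>I\<close>.\<close>
  obtain I where I: "finite I" "real (card (B \<inter> I)) \<ge> (\<alpha> - \<alpha>/2) * real (card I)"
    "real (card (sym_diff (\<one> <# I) I)) < \<alpha>/2 * real (card I)"
    using \<alpha>(2)[unfolded density_ge_def, rule_format, of "{\<one>}" "\<alpha>/2"] \<alpha>(1) by auto
  then have "\<alpha>/2 * real (card I) > 0"
    by (meson le_less_trans of_nat_0_le_iff)
  then show False using I(2) \<open>B = {}\<close> by simp
qed

text \<open>The same \<open>\<alpha>\<close> serves. Sets \<open>I\<close> are taken for
  \<open>B\<close> with \<open>h\<close> added to \<open>F\<close> and tolerance
  \<open>\<epsilon>/2\<close>: one half is spent on the density of \<open>B\<close>, the other on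
  replacing \<open>B\<close> by its shift.\<close>

lemma positive_density_shift:
  assumes "positive_density G B" and h: "h \<in> carrier G"
  shows "positive_density G (shift G h B)"
proof -
  obtain \<alpha> where \<alpha>: "\<alpha> > 0" "density_ge G B \<alpha>"
    using assms by (auto simp: positive_density_def)
  have "density_ge G (shift G h B) \<alpha>"
    unfolding density_ge_def
  proof (intro allI impI)
    fix F and \<epsilon> :: real
    assume F: "finite F" "F \<subseteq> carrier G" and "0 < \<epsilon>"
    then obtain I where I: "finite I" "I \<subseteq> carrier G"
      "real (card (B \<inter> I)) \<ge> (\<alpha> - \<epsilon>/2) * real (card I)"
      "\<forall>g\<in>insert h F. real (card (sym_diff (g <# I) I)) < \<epsilon>/2 * real (card I)"
      using \<alpha>(2)[unfolded density_ge_def, rule_format, of "insert h F" "\<epsilon>/2"] h by auto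
    have "real (card (B \<inter> I)) \<le> real (card (shift G h B \<inter> I)) + real (card (sym_diff (h <# I) I))"
      using card_shift_ge[OF I(1,2) h, of B] by linarith
    then have "real (card (shift G h B \<inter> I)) \<ge> (\<alpha> - \<epsilon>) * real (card I)"
      using I(3,4) by (simp add: algebra_simps)
    moreover have "\<epsilon>/2 * real (card I) \<le> \<epsilon> * real (card I)"
      using \<open>0 < \<epsilon>\<close> by (intro mult_right_mono) auto
    then have "\<forall>g\<in>F. real (card (sym_diff (g <# I) I)) < \<epsilon> * real (card I)"
      using I(4) by force
    ultimately show "\<exists>I. finite I \<and> I \<subseteq> carrier G \<and>
            real (card (shift G h B \<inter> I)) \<ge> (\<alpha> - \<epsilon>) * real (card I) \<and>
            (\<forall>g\<in>F. real (card (sym_diff (g <# I) I)) < \<epsilon> * real (card I))"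
      using I(1,2) by blast
  qed
  then show ?thesis using \<alpha>(1) by (auto simp: positive_density_def)
qed

end

text \<open>Set number \<open>k\<close> meets the union of its predecessors in at most
  \<open>k * d\<close> points, so the total loss is at most \<open>0 + 1 + ... + (k - 1)\<close>
  times \<open>d\<close>; the quadratic bound is a convenient overestimate.\<close>

lemma card_UN_ge_almost_disjoint:
  fixes C :: "nat \<Rightarrow> 'a set" and x d :: real
  assumes "\<And>i. i < k \<Longrightarrow> finite (C i)" and "\<And>i. i < k \<Longrightarrow> real (card (C i)) \<ge> x"
    and "\<And>i j. i < j \<Longrightarrow> j < k \<Longrightarrow> real (card (C i \<inter> C j)) \<le> d" and "d \<ge> 0"
  shows "real (card (\<Union>i<k. C i)) \<ge> real k * x - real k * real k * d"
  using assms(1-3)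
proof (induction k)
  case 0
  then show ?case by simp
next
  case (Suc k)
  let ?U = "\<Union>i<k. C i"
  have IH: "real (card ?U) \<ge> real k * x - real k * real k * d"
    using Suc by simp
  have union: "(\<Union>i<Suc k. C i) = C k \<union> ?U"
    by (simp add: lessThan_Suc)
  have "card (C k) + card ?U = card (\<Union>i<Suc k. C i) + card (C k \<inter> ?U)"
    unfolding union using Suc.prems(1) by (intro card_Un_Int) auto
  then have "real (card (C k)) + real (card ?U) =
      real (card (\<Union>i<Suc k. C i)) + real (card (C k \<inter> ?U))"
    by (simp only: of_nat_add[symmetric])
  moreover have "real (card (C k \<inter> ?U)) \<le> real k * d"
  proof -
    have "C k \<inter> ?U = (\<Union>i<k. C i \<inter> C k)" by auto
    then have "real (card (C k \<inter> ?U)) \<le> real (\<Sum>i<k. card (C i \<inter> C k))"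
      by (simp only: of_nat_le_iff) (rule card_UN_le, simp)
    also have "\<dots> \<le> (\<Sum>i<k. d)"
      unfolding of_nat_sum using Suc.prems(3) by (intro sum_mono) auto
    finally show ?thesis by simp
  qed
  ultimately have "real (card (\<Union>i<Suc k. C i)) \<ge> real k * x - real k * real k * d + x - real k * d"
    using IH Suc.prems(2)[OF lessI] by linarith
  moreover have "real (Suc k) * real (Suc k) * d \<ge> real k * real k * d + real k * d"
    using \<open>d \<ge> 0\<close> by (simp add: algebra_simps)
  ultimately show ?case by (simp add: algebra_simps)
qed

text \<open>Each shift occupies nearly a share \<open>\<alpha>\<close> of every sufficiently
  invariant \<open>I\<close>. If all pairwise intersections lacked positive density, more than
  \<open>2 / \<alpha>\<close> shifts would be almost disjoint inside one common \<open>I\<close> and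
  would overfill it.\<close>

lemma (in group) not_pairwise_almost_disjoint:
  assumes "positive_density G B" and q: "\<And>i::nat. q i \<in> carrier G"
  shows "\<exists>i j. i < j \<and> positive_density G (shift G (q i) B \<inter> shift G (q j) B)"
proof (rule ccontr)
  assume neg: "\<not> ?thesis"
  obtain \<alpha> where \<alpha>: "\<alpha> > 0" "density_ge G B \<alpha>"
    using assms by (auto simp: positive_density_def)
  \<comment> \<open>The constants balance at the end: overlaps cost
    \<open>k * k * \<delta> = 1/4\<close>, and tolerances cost
    \<open>2 * k * \<epsilon>' \<le> 1/4\<close>, so the union would fill more than
    \<open>2 - 1/2\<close> times \<open>I\<close>.\<close>
  obtain k :: nat where k: "real k * \<alpha> > 2"
    using ex_less_of_nat_mult[OF \<alpha>(1), of 2] by blast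
  then have kpos: "k > 0" by (cases k) auto
  define \<delta> where "\<delta> = 1 / (4 * real k * real k)"
  have \<delta>: "\<delta> > 0" using kpos by (simp add: \<delta>_def)
  let ?C = "\<lambda>i. shift G (q i) B"
  \<comment> \<open>The negation of \<open>density_ge\<close> at level \<open>\<delta>\<close>: all
    \<open>I\<close> invariant enough for \<open>F\<close> and \<open>\<epsilon>\<close> see a small
    intersection, so the bound may be applied to an \<open>I\<close> chosen for other
    reasons.\<close>
  let ?fails = "\<lambda>i j F \<epsilon>. finite F \<and> F \<subseteq> carrier G \<and> \<epsilon> > 0 \<and>
     (\<forall>I. finite I \<longrightarrow> I \<subseteq> carrier G \<longrightarrow>
        (\<forall>g\<in>F. real (card (sym_diff (g <# I) I)) < \<epsilon> * real (card I)) \<longrightarrow>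
        real (card (?C i \<inter> ?C j \<inter> I)) < (\<delta> - \<epsilon>) * real (card I))"
  have "\<exists>F \<epsilon>. ?fails i j F \<epsilon>" if "i < j" for i j
  proof -
    have "\<not> density_ge G (?C i \<inter> ?C j) \<delta>"
      using neg that \<delta> by (auto simp: positive_density_def)
    then obtain F \<epsilon> where "finite F" "F \<subseteq> carrier G" "\<epsilon> > 0"
      "\<not> (\<exists>I. finite I \<and> I \<subseteq> carrier G \<and>
            real (card (?C i \<inter> ?C j \<inter> I)) \<ge> (\<delta> - \<epsilon>) * real (card I) \<and>
            (\<forall>g\<in>F. real (card (sym_diff (g <# I) I)) < \<epsilon> * real (card I)))"
      unfolding density_ge_def by blast
    then show ?thesis by (intro exI[of _ F] exI[of _ \<epsilon>]) (simp add: not_le[symmetric], blast)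
  qed
  then obtain F \<epsilon> where fails: "\<And>i j. i < j \<Longrightarrow> ?fails i j (F i j) (\<epsilon> i j)"
    by metis
  define Q where "Q = {(i, j). i < j \<and> j < k}"
  have "finite Q"
    by (rule finite_subset[of _ "{..<k} \<times> {..<k}"]) (auto simp: Q_def)
  \<comment> \<open>One demand at least as strict as those of all pairs below \<open>k\<close>. It
    also includes the shifting elements, as \<open>card_shift_ge\<close> needs near invariance under
    them.\<close>
  define F' where "F' = q ` {..<k} \<union> (\<Union>(i, j)\<in>Q. F i j)"
  define \<epsilon>' where "\<epsilon>' = Min (insert (1 / (8 * real k)) ((\<lambda>(i, j). \<epsilon> i j) ` Q))"
  have "finite F'" "F' \<subseteq> carrier G"
    using fails q \<open>finite Q\<close> by (fastforce simp: F'_def Q_def)+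
  moreover have "\<epsilon>' > 0"
    using fails kpos \<open>finite Q\<close> by (auto simp: \<epsilon>'_def Q_def)
  ultimately obtain I where I: "finite I" "I \<subseteq> carrier G"
      "real (card (B \<inter> I)) \<ge> (\<alpha> - \<epsilon>') * real (card I)"
      "\<And>g. g \<in> F' \<Longrightarrow> real (card (sym_diff (g <# I) I)) < \<epsilon>' * real (card I)"
    using \<alpha>(2)[unfolded density_ge_def, rule_format, of F' \<epsilon>'] by auto
  \<comment> \<open>A strict inequality at any element of \<open>F'\<close> makes \<open>I\<close>
    nonempty, so \<open>card I\<close> can be cancelled below.\<close>
  have "q 0 \<in> F'" using kpos by (auto simp: F'_def)
  from I(4)[OF this] have "\<epsilon>' * real (card I) > 0"
    by (meson le_less_trans of_nat_0_le_iff)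
  then have Ipos: "real (card I) > 0"
    using \<open>\<epsilon>' > 0\<close> by (simp add: zero_less_mult_iff)
  have large: "real (card (?C i \<inter> I)) \<ge> (\<alpha> - 2 * \<epsilon>') * real (card I)" if "i < k" for i
  proof -
    have "q i \<in> F'" using that by (auto simp: F'_def)
    from I(3) I(4)[OF this] show ?thesis
      using card_shift_ge[OF I(1,2) q[of i], of B] by (simp add: algebra_simps)
  qed
  have small: "real (card ((?C i \<inter> I) \<inter> (?C j \<inter> I))) \<le> \<delta> * real (card I)"
    if "i < j" "j < k" for i j
  proof -
    have "(i, j) \<in> Q" using that by (simp add: Q_def)
    then have "\<epsilon>' \<le> \<epsilon> i j" "F i j \<subseteq> F'"
      using \<open>finite Q\<close> by (auto simp: \<epsilon>'_def F'_def intro!: Min_le)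
    have "\<epsilon>' * real (card I) \<le> \<epsilon> i j * real (card I)"
      using \<open>\<epsilon>' \<le> \<epsilon> i j\<close> by (intro mult_right_mono) auto
    then have "\<forall>g\<in>F i j. real (card (sym_diff (g <# I) I)) < \<epsilon> i j * real (card I)"
      using I(4) \<open>F i j \<subseteq> F'\<close> by force
    then have "real (card (?C i \<inter> ?C j \<inter> I)) < (\<delta> - \<epsilon> i j) * real (card I)"
      using fails[OF that(1)] I(1,2) by blast
    also have "\<dots> \<le> \<delta> * real (card I)"
      using fails[OF that(1)] by (intro mult_right_mono) auto
    finally show ?thesis by (simp add: Int_ac)
  qed
  have "real k * ((\<alpha> - 2 * \<epsilon>') * real (card I)) - real k * real k * (\<delta> * real (card I))
      \<le> real (card (\<Union>i<k. ?C i \<inter> I))"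
    using I(1) large small \<delta> by (intro card_UN_ge_almost_disjoint) auto
  also have "\<dots> \<le> real (card I)"
    using I(1) by (auto intro!: card_mono)
  finally have "(real k * \<alpha> - 2 * (real k * \<epsilon>') - real k * real k * \<delta>) * real (card I)
      \<le> 1 * real (card I)"
    by (simp add: algebra_simps)
  then have "real k * \<alpha> - 2 * (real k * \<epsilon>') - real k * real k * \<delta> \<le> 1"
    using Ipos by (simp only: mult_le_cancel_right_pos)
  moreover have "real k * real k * \<delta> = 1/4"
    using kpos by (simp add: \<delta>_def)
  moreover have "\<epsilon>' \<le> 1 / (8 * real k)"
    using \<open>finite Q\<close> by (simp add: \<epsilon>'_def)
  then have "real k * \<epsilon>' \<le> 1/8"
    using kpos by (simp add: field_simps)
  ultimately show False using k by linarith
qed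

subsection \<open>Simultaneous returns\<close>

text \<open>Requirements are added one at a time, each time passing to an infinite homogeneous
  subset. The bad colour cannot be the homogeneous one, since every infinite set contains a good
  pair.\<close>

lemma infinite_simultaneous_pairs:
  fixes good :: "'k \<Rightarrow> nat \<Rightarrow> nat \<Rightarrow> bool"
  assumes "finite K"
    and "\<And>k a b. k \<in> K \<Longrightarrow> good k a b \<Longrightarrow> good k b a"
    and "\<And>k Z. k \<in> K \<Longrightarrow> infinite Z \<Longrightarrow> \<exists>a\<in>Z. \<exists>b\<in>Z. a \<noteq> b \<and> good k a b"
    and "infinite Z"
  shows "\<exists>Y\<subseteq>Z. infinite Y \<and> (\<forall>k\<in>K. \<forall>a\<in>Y. \<forall>b\<in>Y. a \<noteq> b \<longrightarrow> good k a b)"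
  using assms(1-3)
proof (induction K)
  case empty
  then show ?case using assms(4) by blast
next
  case (insert k K)
  obtain Y where Y: "Y \<subseteq> Z" "infinite Y" "\<forall>k\<in>K. \<forall>a\<in>Y. \<forall>b\<in>Y. a \<noteq> b \<longrightarrow> good k a b"
    using insert.IH insert.prems by (metis insertCI)
  \<comment> \<open>\<open>Ramsey2\<close> colours unordered pairs; symmetry of \<open>good\<close>
    makes the colour of \<open>{a, b}\<close> decide \<open>good k a b\<close>.\<close>
  define f :: "nat set \<Rightarrow> nat" where "f S = (if \<exists>a b. S = {a, b} \<and> good k a b then 1 else 0)" for S
  have f: "f {a, b} = 1 \<longleftrightarrow> good k a b" for a b
    using insert.prems(1)[of k] by (auto simp: f_def doubleton_eq_iff)
  have "\<forall>a\<in>Y. \<forall>b\<in>Y. a \<noteq> b \<longrightarrow> f {a, b} < 2"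
    by (simp add: f_def)
  from Ramsey2[OF Y(2) this] obtain W c where W: "W \<subseteq> Y" "infinite W"
    "\<forall>a\<in>W. \<forall>b\<in>W. a \<noteq> b \<longrightarrow> f {a, b} = c"
    by blast
  obtain a b where "a \<in> W" "b \<in> W" "a \<noteq> b" "good k a b"
    using insert.prems(2)[of k, OF _ W(2)] by blast
  then have "c = 1" using W(3) f by metis
  then have "\<forall>a\<in>W. \<forall>b\<in>W. a \<noteq> b \<longrightarrow> good k a b" using W(3) f by blast
  moreover have "\<forall>k\<in>K. \<forall>a\<in>W. \<forall>b\<in>W. a \<noteq> b \<longrightarrow> good k a b"
    using Y(3) W(1) by (meson subsetD)
  moreover have "W \<subseteq> Z" using W(1) Y(1) by (rule subset_trans)
  ultimately show ?case using W(2) by (intro exI[of _ W]) simp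
qed

text \<open>A requirement is a pair \<open>(B, s)\<close>; indices \<open>a\<close>,
  \<open>b\<close> meet it if the shifts of \<open>B\<close> by \<open>inv (p s a)\<close> and
  \<open>inv (p s b)\<close> intersect in positive density. Ramsey gives infinitely many indices
  from \<open>N\<close> on that meet all requirements pairwise.\<close>

lemma (in group) simultaneous_return:
  assumes \<B>: "finite \<B>" "\<And>B. B \<in> \<B> \<Longrightarrow> positive_density G B"
    and S: "finite S" and g: "\<And>n s. s \<in> S \<Longrightarrow> g n s \<in> carrier G"
  shows "\<exists>a b. N \<le> a \<and> a < b \<and>
    (\<forall>B\<in>\<B>. \<forall>s\<in>S. positive_density G (B \<inter> shift G (ordered_prod G (\<lambda>j. g j s) {a..<b}) B))"
proof -
  define p where "p s n = ordered_prod G (\<lambda>j. g j s) {..<n}" for s n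
  have p: "p s n \<in> carrier G" if "s \<in> S" for s n
    using g that by (simp add: p_def ordered_prod_closed)
  let ?C = "\<lambda>B s n. shift G (inv (p s n)) B"
  let ?good = "\<lambda>(B, s) a b. positive_density G (?C B s a \<inter> ?C B s b)"
  have "\<exists>Y\<subseteq>{N..}. infinite Y \<and> (\<forall>k\<in>\<B> \<times> S. \<forall>a\<in>Y. \<forall>b\<in>Y. a \<noteq> b \<longrightarrow> ?good k a b)"
  proof (rule infinite_simultaneous_pairs)
    fix k and Z :: "nat set"
    assume "k \<in> \<B> \<times> S" and Z: "infinite Z"
    then obtain B s where k: "k = (B, s)" "B \<in> \<B>" "s \<in> S" by auto
    obtain i j where "i < j"
      "positive_density G (?C B s (enumerate Z i) \<inter> ?C B s (enumerate Z j))"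
      using not_pairwise_almost_disjoint[OF \<B>(2)[OF k(2)], of "\<lambda>i. inv (p s (enumerate Z i))"]
        p[OF k(3)] by auto
    moreover have "enumerate Z i \<noteq> enumerate Z j"
      using enumerate_mono[OF \<open>i < j\<close> Z] by simp
    ultimately show "\<exists>a\<in>Z. \<exists>b\<in>Z. a \<noteq> b \<and> ?good k a b"
      unfolding k(1) prod.case using enumerate_in_set[OF Z] by blast
  qed (use \<B>(1) S in \<open>auto simp: Int_commute infinite_Ici\<close>)
  then obtain Y where Y: "Y \<subseteq> {N..}" "infinite Y"
    "\<And>B s a b. B \<in> \<B> \<Longrightarrow> s \<in> S \<Longrightarrow> a \<in> Y \<Longrightarrow> b \<in> Y \<Longrightarrow> a \<noteq> b \<Longrightarrow>
       positive_density G (?C B s a \<inter> ?C B s b)"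
    by fastforce
  define a b where "a = enumerate Y 0" and "b = enumerate Y 1"
  have ab: "a \<in> Y" "b \<in> Y" "a < b"
    using enumerate_in_set[OF Y(2)] enumerate_mono[OF zero_less_one Y(2)]
    unfolding a_def b_def by blast+
  have "positive_density G (B \<inter> shift G (ordered_prod G (\<lambda>j. g j s) {a..<b}) B)"
    if "B \<in> \<B>" "s \<in> S" for B s
  proof -
    let ?x = "ordered_prod G (\<lambda>j. g j s) {a..<b}"
    have x: "?x \<in> carrier G" using g that by (simp add: ordered_prod_closed)
    \<comment> \<open>Shifting once more by \<open>p s b\<close> cancels the initial products: one
      shift of \<open>B\<close> becomes \<open>B\<close> itself, the other its shift by
      \<open>?x\<close>.\<close>
    have pb: "p s b = p s a \<otimes> ?x"
      unfolding p_def using g that ab(3) by (intro ordered_prod_interval_split) auto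
    have "inv (p s a) \<otimes> (p s b \<otimes> y) = ?x \<otimes> y" "inv (p s b) \<otimes> (p s b \<otimes> y) = y"
      if y: "y \<in> carrier G" for y
    proof -
      show "inv (p s a) \<otimes> (p s b \<otimes> y) = ?x \<otimes> y"
        using x y p[OF \<open>s \<in> S\<close>] by (simp add: pb m_assoc[symmetric])
      show "inv (p s b) \<otimes> (p s b \<otimes> y) = y"
        using y p[OF \<open>s \<in> S\<close>] by (simp add: m_assoc[symmetric])
    qed
    then have "shift G (p s b) (?C B s a \<inter> ?C B s b) = B \<inter> shift G ?x B"
      using p[OF \<open>s \<in> S\<close>] by (auto simp: shift_def)
    moreover have "positive_density G (shift G (p s b) (?C B s a \<inter> ?C B s b))"
      using Y(3)[OF that ab(1,2)] ab(3) p[OF \<open>s \<in> S\<close>] by (intro positive_density_shift) auto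
    ultimately show ?thesis by simp
  qed
  then show ?thesis using ab Y(1) by (intro exI[of _ a] exI[of _ b]) auto
qed

text \<open>The alternative \<open>h e = \<one>\<close> covers inner products with no factors. The
  node \<open>s\<close> may depend on \<open>e\<close>, so each stage must serve every node and
  every set arising from earlier choices.\<close>

lemma (in group) return_intervals:
  assumes A: "A \<subseteq> carrier G" "positive_density G A"
    and S: "finite S" and g: "\<And>n s. s \<in> S \<Longrightarrow> g n s \<in> carrier G"
  obtains a b :: "nat \<Rightarrow> nat" where "\<And>n. a n < b n" and "\<And>n. b n \<le> a (Suc n)"
    and "\<And>F h. finite F \<Longrightarrow>
      (\<And>e. e \<in> F \<Longrightarrow> h e = \<one> \<or> (\<exists>s\<in>S. h e = ordered_prod G (\<lambda>j. g j s) {a e..<b e})) \<Longrightarrow>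
      ordered_prod G h F \<in> quotient_set G A"
proof -
  let ?x = "\<lambda>a b s. ordered_prod G (\<lambda>j. g j s) {a..<b}"
  define ok where "ok n X \<longleftrightarrow> (case X of (a, b, \<B>) \<Rightarrow>
      a < b \<and> finite \<B> \<and> A \<in> \<B> \<and> (\<forall>B\<in>\<B>. positive_density G B))"
    for n :: nat and X :: "nat \<times> nat \<times> 'a set set"
  \<comment> \<open>Old sets are retained for the case that \<open>F\<close> omits the stage or its
    factor is \<open>\<one>\<close>; the new sets are for a factor coming from
    \<open>s\<close>.\<close>
  define next_ok where "next_ok n X Y \<longleftrightarrow> (case (X, Y) of ((a, b, \<B>), (a', b', \<B>')) \<Rightarrow>
      b \<le> a' \<and> \<B> \<subseteq> \<B>' \<and> (\<forall>B\<in>\<B>. \<forall>s\<in>S. B \<inter> shift G (?x a' b' s) B \<in> \<B>'))"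
    for n :: nat and X Y :: "nat \<times> nat \<times> 'a set set"
  have "\<exists>X. \<forall>n. ok n (X n) \<and> next_ok n (X n) (X (Suc n))"
  proof (rule dependent_nat_choice)
    show "\<exists>X. ok 0 X"
      using A(2) by (intro exI[of _ "(0, 1, {A})"]) (simp add: ok_def)
  next
    fix X n assume "ok n X"
    then obtain a b \<B> where X: "X = (a, b, \<B>)" "finite \<B>" "A \<in> \<B>"
      "\<And>B. B \<in> \<B> \<Longrightarrow> positive_density G B"
      by (cases X) (auto simp: ok_def)
    obtain a' b' where ab': "b \<le> a'" "a' < b'"
      "\<forall>B\<in>\<B>. \<forall>s\<in>S. positive_density G (B \<inter> shift G (?x a' b' s) B)"
      using simultaneous_return[of \<B> S g b, OF X(2,4) S] g by blast
    define \<B>' where "\<B>' = \<B> \<union> (\<lambda>(B, s). B \<inter> shift G (?x a' b' s) B) ` (\<B> \<times> S)"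
    have "ok (Suc n) (a', b', \<B>')" "next_ok n X (a', b', \<B>')"
      using X ab' S by (auto simp: ok_def next_ok_def \<B>'_def)
    then show "\<exists>Y. ok (Suc n) Y \<and> next_ok n X Y" by blast
  qed
  then obtain X where X: "\<And>n. ok n (X n)" "\<And>n. next_ok n (X n) (X (Suc n))" by blast
  \<comment> \<open>The index is moved by one to discard the dummy interval of the initial state:
    interval \<open>n\<close> is the one chosen to serve the family \<open>\<B> n\<close>.\<close>
  define a where "a n = fst (X (Suc n))" for n
  define b where "b n = fst (snd (X (Suc n)))" for n
  define \<B> where "\<B> n = snd (snd (X n))" for n
  have ab: "a n < b n" "b n \<le> a (Suc n)" for n
    using X(1)[of "Suc n"] X(2)[of "Suc n"]
    by (auto simp: ok_def next_ok_def a_def b_def split: prod.splits)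
  have \<B>: "A \<in> \<B> n" "\<B> n \<subseteq> \<B> (Suc n)" "\<And>B. B \<in> \<B> n \<Longrightarrow> positive_density G B"
    "\<And>B s. B \<in> \<B> n \<Longrightarrow> s \<in> S \<Longrightarrow> B \<inter> shift G (?x (a n) (b n) s) B \<in> \<B> (Suc n)" for n
    using X(1)[of n] X(2)[of n]
    by (auto simp: ok_def next_ok_def a_def b_def \<B>_def split: prod.splits)
  have "ordered_prod G h F \<in> quotient_set G A"
    if F: "finite F" and h: "\<And>e. e \<in> F \<Longrightarrow> h e = \<one> \<or> (\<exists>s\<in>S. h e = ?x (a e) (b e) s)" for F h
  proof -
    have hc: "h e \<in> carrier G" if "e \<in> F" for e
      using h[OF that] g by (auto simp: ordered_prod_closed)
    \<comment> \<open>With \<open>w\<close> the product over indices below \<open>n\<close>, the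
      invariant is \<open>w \<otimes> y \<in> A\<close> on \<open>B\<close>. For a new factor
      \<open>h n\<close>, restricting to \<open>y\<close> with
      \<open>h n \<otimes> y \<in> B\<close> preserves it.\<close>
    have step: "\<exists>B\<in>\<B> n. B \<subseteq> A \<and> (\<forall>y\<in>B. ordered_prod G h (F \<inter> {..<n}) \<otimes> y \<in> A)" for n
    proof (induction n)
      case 0
      then show ?case using \<B>(1) A(1) by (intro bexI[of _ A]) auto
    next
      case (Suc n)
      let ?w = "ordered_prod G h (F \<inter> {..<n})"
      obtain B where B: "B \<in> \<B> n" "B \<subseteq> A" "\<And>y. y \<in> B \<Longrightarrow> ?w \<otimes> y \<in> A"
        using Suc by blast
      have w: "?w \<in> carrier G" using F hc by (intro ordered_prod_closed) auto
      show ?case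
      proof (cases "n \<in> F")
        case False
        then have "F \<inter> {..<Suc n} = F \<inter> {..<n}" by (auto simp: less_Suc_eq)
        then show ?thesis using B \<B>(2)[of n] by (intro bexI[of _ B]) auto
      next
        case True
        then have "F \<inter> {..<Suc n} = insert n (F \<inter> {..<n})" by auto
        then have w': "ordered_prod G h (F \<inter> {..<Suc n}) = ?w \<otimes> h n"
          by (simp only:) (rule ordered_prod_insert_greatest, use F hc True in auto)
        consider "h n = \<one>" | s where "s \<in> S" "h n = ?x (a n) (b n) s"
          using h[OF True] by blast
        then show ?thesis
        proof cases
          case 1
          then show ?thesis using w w' B \<B>(2)[of n] by (intro bexI[of _ B]) auto
        next
          case (2 s)
          have "(?w \<otimes> h n) \<otimes> y = ?w \<otimes> (h n \<otimes> y)" if "y \<in> carrier G" for y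
            using w hc[OF True] that by (simp add: m_assoc)
          then show ?thesis
            using \<B>(4)[OF B(1) 2(1)] B(2,3)
            by (intro bexI[of _ "B \<inter> shift G (h n) B"]) (auto simp: shift_def w' 2(2)[symmetric])
        qed
      qed
    qed
    obtain n where "F \<subseteq> {..<n}"
      using finite_nat_iff_bounded[of F] F by blast
    then have "F \<inter> {..<n} = F" by blast
    with step[of n] obtain B where B: "B \<in> \<B> n" "B \<subseteq> A" "\<forall>y\<in>B. ordered_prod G h F \<otimes> y \<in> A"
      by auto
    obtain y where y: "y \<in> B"
      using positive_density_nonempty[OF \<B>(3)[OF B(1)]] by blast
    have "ordered_prod G h F = (ordered_prod G h F \<otimes> y) \<otimes> inv y"
      using ordered_prod_closed[of F h] F hc A(1) B(2) y by (auto simp: m_assoc)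
    then show ?thesis using B y unfolding quotient_set_def by blast
  qed
  with ab show thesis using that by blast
qed

subsection \<open>Constant maps into the tree\<close>

text \<open>\<open>FIN\<close> asks for a branch around the range. Among the finitely many chains
  through \<open>t\<close> one is maximal, and every chain extending it still contains
  \<open>t\<close>.\<close>

lemma (in finite_rooted_tree) node_in_branch:
  assumes "t \<in> T"
  shows "\<exists>C. tree_branch T P C \<and> t \<in> C"
proof -
  let ?\<C> = "{C. pred_on.chain T (tree_le P) C \<and> t \<in> C}"
  have "?\<C> \<subseteq> Pow T" by (auto simp: pred_on.chain_def)
  then have fin: "finite ?\<C>" using finite_nodes finite_subset by blast
  have "{t} \<in> ?\<C>" using assms by (auto simp: pred_on.chain_def)
  then obtain C where C: "C \<in> ?\<C>" "\<forall>D\<in>?\<C>. C \<subseteq> D \<longrightarrow> C = D"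
    using finite_has_maximal2[OF fin] by blast
  then have "tree_branch T P C"
    by (auto simp: tree_branch_def pred_on.maxchain_def)
  then show ?thesis using C(1) by blast
qed

lemma (in finite_rooted_tree) constant_in_FIN_at:
  assumes "t \<in> T" "t \<noteq> r" "finite D" "D \<noteq> {}"
  shows "(\<lambda>j. if j \<in> D then Some t else None) \<in> FIN_at T r P t"
proof -
  let ?b = "\<lambda>j. if j \<in> D then Some t else None"
  have "ran ?b = {t}" "dom ?b = D"
    using assms(4) by (auto simp: ran_def dom_def)
  moreover obtain C where "tree_branch T P C" "t \<in> C"
    using node_in_branch assms(1) by blast
  ultimately show ?thesis
    using assms by (auto simp: FIN_at_def FIN_def tree_chain_def pred_on.chain_def tree_le_def)
qed

theorem theorem7p3:
  fixes G :: "('g, 'm) monoid_scheme"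
    and T :: "'t set" and r :: 't and P :: "('t \<times> 't) set"
    and A :: "'g set"
    and g :: "nat \<Rightarrow> 't \<Rightarrow> 'g"
  assumes "amenable_group G"
    and "finite_rooted_tree T r P"
    and "A \<subseteq> carrier G" and "positive_density G A"
    and "\<And>n. g n \<in> (T - {r}) \<rightarrow> carrier G"
  shows "\<exists>b :: nat \<Rightarrow> 't \<Rightarrow> (nat \<rightharpoonup> 't).
    (\<forall>n. \<forall>t\<in>T. b n t \<in> FIN_at T r P t) \<and>
    (\<forall>n. \<forall>t\<in>T. set_before (dom (b n t)) (dom (b (Suc n) t))) \<and>
    (\<forall>(F :: nat set) (f :: nat \<Rightarrow> 't \<Rightarrow> 't) (t :: nat \<Rightarrow> 't).
       finite F \<longrightarrow> F \<noteq> {} \<longrightarrow>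
       (\<forall>e\<in>F. regressive_hom T P (f e)) \<longrightarrow>
       (\<forall>e\<in>F. t e \<in> T) \<longrightarrow>
       tree_chain T P ((\<lambda>e. f e (t e)) ` F) \<longrightarrow>
       ordered_prod G
         (\<lambda>e. ordered_prod G
            (\<lambda>j. g j (f e (the (b e (t e) j))))
            {j \<in> dom (b e (t e)). f e (the (b e (t e) j)) \<in> T - {r}})
         F
       \<in> quotient_set G A)"
proof -
  interpret amenable_group G by fact
  interpret finite_rooted_tree T r P by fact
  have g: "g n s \<in> carrier G" if "s \<in> T - {r}" for n s
    using assms(5) that by (auto simp: Pi_iff)
  obtain a b where ab: "\<And>n. a n < b n" "\<And>n. b n \<le> a (Suc n)"
    and prod: "\<And>F h. finite F \<Longrightarrow>
      (\<And>e. e \<in> F \<Longrightarrow> h e = \<one>\<^bsub>G\<^esub> \<or> (\<exists>s\<in>T - {r}. h e = ordered_prod G (\<lambda>j. g j s) {a e..<b e})) \<Longrightarrow>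
      ordered_prod G h F \<in> quotient_set G A"
    using return_intervals[OF assms(3,4), of "T - {r}" g] finite_nodes g
    by (metis finite_Diff)
  \<comment> \<open>The root needs its own case because \<open>FIN_at\<close> admits only the empty
    map there; elsewhere \<open>a n < b n\<close> keeps the range nonempty.\<close>
  define c :: "nat \<Rightarrow> 't \<Rightarrow> (nat \<rightharpoonup> 't)" where
    "c n t = (if t = r then Map.empty else (\<lambda>j. if j \<in> {a n..<b n} then Some t else None))" for n t
  have dom_c: "dom (c n t) = (if t = r then {} else {a n..<b n})" for n t
    by (auto simp: c_def dom_def)
  show ?thesis
  proof (intro exI[of _ c] conjI allI ballI impI)
    fix n t assume "t \<in> T"
    then show "c n t \<in> FIN_at T r P t"
      using constant_in_FIN_at[of t "{a n..<b n}"] ab(1)[of n]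
      by (cases "t = r") (auto simp: c_def FIN_at_def)
    show "set_before (dom (c n t)) (dom (c (Suc n) t))"
      using ab(2)[of n] by (auto simp: set_before_def dom_c)
  next
    fix F :: "nat set" and f :: "nat \<Rightarrow> 't \<Rightarrow> 't" and t :: "nat \<Rightarrow> 't"
    assume F: "finite F" and f: "\<forall>e\<in>F. regressive_hom T P (f e)" and t: "\<forall>e\<in>F. t e \<in> T"
    show "ordered_prod G
         (\<lambda>e. ordered_prod G
            (\<lambda>j. g j (f e (the (c e (t e) j))))
            {j \<in> dom (c e (t e)). f e (the (c e (t e) j)) \<in> T - {r}})
         F
       \<in> quotient_set G A"
    proof (rule prod[OF F])
      fix e assume "e \<in> F"
      then have "f e \<in> T \<rightarrow> T" "t e \<in> T"
        using f t unfolding regressive_hom_def by blast+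
      then have fT: "f e (t e) \<in> T"
        by (rule funcset_mem)
      let ?J = "{j \<in> dom (c e (t e)). f e (the (c e (t e) j)) \<in> T - {r}}"
      let ?h = "\<lambda>j. g j (f e (the (c e (t e) j)))"
      show "ordered_prod G ?h ?J = \<one>\<^bsub>G\<^esub> \<or>
        (\<exists>s\<in>T - {r}. ordered_prod G ?h ?J = ordered_prod G (\<lambda>j. g j s) {a e..<b e})"
      \<comment> \<open>The composite of \<open>f e\<close> with a constant map is constant, so the
        index filter keeps the whole interval or nothing. In the former case
        \<open>f e (t e)\<close> is the required node \<open>s\<close>.\<close>
      proof (cases "t e = r \<or> f e (t e) = r")
        case True
        then have "?J = {}" by (auto simp: c_def split: if_splits)
        then show ?thesis by (simp only: ordered_prod_empty simp_thms)
      next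
        case False
        then have J: "?J = {a e..<b e}" using fT by (auto simp: c_def split: if_splits)
        have "ordered_prod G ?h {a e..<b e} = ordered_prod G (\<lambda>j. g j (f e (t e))) {a e..<b e}"
          using False by (intro ordered_prod_cong) (auto simp: c_def)
        then show ?thesis unfolding J using False fT by blast
      qed
    qed
  qed
qed

end
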